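(* Let $G$ be a property graph, $Q[\bar u]$ a graph pattern, $H$ the set of all matches (homomorphisms) of $Q[\bar u]$ in $G$, and $\mathcal{I}$ the set of all items over $Q[\bar u]$. Let $X\subseteq\mathcal{I}$ be an itemset and let $\alpha[u;c]\in\mathcal{I}$ be an item with $\alpha[u;c]\notin X$. Then the dependency $X\to\alpha[u;c]$ holds over $H$ (that is, every $h\in H$ with $h\models X$ satisfies $h\models\alpha[u;c]$) if and only if $X$ covers the necessary set $nec(\alpha[u;c])$.
   Context: Let $\mathbf{A},\mathbf{L},\mathbf{C}$ be countably infinite sets of attributes, labels and constants. Graph. A property graph is $G=(V,E,L,F_A)$, where $V$ is a finite set of nodes; $E\subseteq V\times\mathbf{L}\times V$ is a finite set of labelled directed edges; each node $v$ has an identity $v.id$ (a special attribute) and a label $L(v)\in\mathbf{L}$; and each node $v$ has a list $F_A(v)=[(A_1,c_1),\dots,(A_n,c_n)]$ of attribute-value pairs with $A_i\in\mathbf{A}$, $c_i\in\mathbf{C}$ and $A_i\ne A_j$ for $i\neq j$, written $v.A_i=c_i$. Pattern. A graph pattern $Q[\bar u]=(V_Q,E_Q,L_Q)$ is a directed graph whose nodes and edges are assigned labels from $\mathbf{L}$ (including the wildcard "*") by $L_Q$; $\bar u$ is the collection of all nodes in $V_Q$, called pattern variables. Two labels match, $l\asymp l'$, iff $l=l'$ or one of them is "*". Match. A match of $Q[\bar u]$ in $G$ is a homomorphism $h$ from $Q$ to $G$ such that $L_Q(v)\asymp L(h(v))$ for each $v\in V_Q$, and for each edge $(v,l,v')\in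 E_Q$ there is an edge $(h(v),l',h(v'))$ in $G$ with $l\asymp l'$. $H$ denotes the set of all matches of $Q[\bar u]$ in $G$. Literals. A literal of $\bar u$ is one of $x.A=c$, $x.A=y.A'$, $x.id=y.id$, with $x,y\in\bar u$, $A,A'\in\mathbf{A}$ non-$id$ attributes, $c\in\mathbf{C}$. A match $h$ satisfies $x.A=c$ if the attribute $h(x).A$ exists and equals $c$; it satisfies $x.A=y.A'$ if $h(x).A$ and $h(y).A'$ both exist and have the same value; it satisfies $x.id=y.id$ if $h(x).id=h(y).id$. Items. An item is a triple $\alpha[u;c]$ consisting of an item-name $\alpha$ (an attribute of a pattern variable), pattern variable(s) $u\subseteq\bar u$, and a constant $c\in\mathbf{C}$ (or the placeholder "_"). Items encode literals: $x.A=c$ is encoded by $\alpha[x;c]$; $x.A_1=y.A_2$ is encoded by $\alpha_{12}[x,y;\_]$; $x.id=y.id$ is encoded by $id[x,y;\_]$. Constant items are defined for the attributes of the pattern variables in $\bar u$, and variable items are defined over pairs of pattern variables of the same kind. $\mathcal{I}$ denotes the set of all items over $Q[\bar u]$. A match $h$ satisfies an item, $h\models\alpha[u;c]$, iff $h$ satisfies the literal it encodes. An itemset is a set of items with pairwise distinct item-names, and $h\models X$ iff $h$ satisfies every item in $X$. Disagree and necessary sets. For $h\in H$, the disagree set is $D(h)=\{\beta\in\mathcal{I}\mid h\not\models\beta\}$. For an item $\alpha[u;c]$, the necessary set is the family of sets of items $$nec(\alpha[u;c])=\{D(h)\setminus\{\alpha[u;c]\}\mid h\in H,\ \alpha[u;c]\in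 D(h)\}.$$ Cover. A set $M\subseteq\mathcal{I}$ covers a family $\mathcal{F}$ of subsets of $\mathcal{I}$ iff $Y\cap M\ne\emptyset$ for every $Y\in\mathcal{F}$. *)

theory Defs
  imports Main "HOL-Library.FuncSet" "HOL-Library.Countable" "HOL-Library.Infinite_Typeclass"
begin

(* The universe of labels is the type 'l label; it contains the wildcard "*". *)
datatype 'l label = Wildcard | Label 'l

definition label_match :: "'l label \<Rightarrow> 'l label \<Rightarrow> bool" (infix "\<asymp>" 50) where
  "l \<asymp> l' \<longleftrightarrow> l = l' \<or> l = Wildcard \<or> l' = Wildcard"

(* The type 'a ranges over the attributes other than the special attribute id; the latter is
   the separate field node_id, with identities in an arbitrary type 'i. *)
record ('v, 'l, 'a, 'c, 'i) property_graph =
  nodes :: "'v set"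
  edges :: "('v \<times> 'l label \<times> 'v) set"
  node_label :: "'v \<Rightarrow> 'l label"
  node_id :: "'v \<Rightarrow> 'i"
  node_attrs :: "'v \<Rightarrow> ('a \<times> 'c) list"

definition property_graph :: "('v, 'l, 'a, 'c, 'i) property_graph \<Rightarrow> bool" where
  "property_graph G \<longleftrightarrow>
     finite (nodes G) \<and>
     edges G \<subseteq> nodes G \<times> UNIV \<times> nodes G \<and>
     finite (edges G) \<and>
     (\<forall>v \<in> nodes G. distinct (map fst (node_attrs G v)))"

(* The value of v.A, or None if v does not have the attribute A. *)
definition attr_val :: "('v, 'l, 'a, 'c, 'i) property_graph \<Rightarrow> 'v \<Rightarrow> 'a \<Rightarrow> 'c option" where
  "attr_val G v A = map_of (node_attrs G v) A"

record ('x, 'l) graph_pattern =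
  pvars :: "'x set"
  pedges :: "('x \<times> 'l label \<times> 'x) set"
  plabel :: "'x \<Rightarrow> 'l label"

definition graph_pattern :: "('x, 'l) graph_pattern \<Rightarrow> bool" where
  "graph_pattern Q \<longleftrightarrow> pedges Q \<subseteq> pvars Q \<times> UNIV \<times> pvars Q"

(* Extensional functions, so that a match is determined by its values on the pattern variables. *)
definition matches ::
    "('v, 'l, 'a, 'c, 'i) property_graph \<Rightarrow> ('x, 'l) graph_pattern \<Rightarrow> ('x \<Rightarrow> 'v) set" where
  "matches G Q =
     {h \<in> pvars Q \<rightarrow>\<^sub>E nodes G.
        (\<forall>x \<in> pvars Q. plabel Q x \<asymp> node_label G (h x)) \<and>
        (\<forall>(x, l, y) \<in> pedges Q. \<exists>l'. (h x, l', h y) \<in> edges G \<and> l \<asymp> l')}"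

(* x.A = c,  x.A = y.A',  x.id = y.id *)
datatype ('x, 'a, 'c) literal =
    Const_Lit 'x 'a 'c
  | Var_Lit 'x 'a 'x 'a
  | Id_Lit 'x 'x

fun literal_vars :: "('x, 'a, 'c) literal \<Rightarrow> 'x set" where
  "literal_vars (Const_Lit x A c) = {x}"
| "literal_vars (Var_Lit x A y A') = {x, y}"
| "literal_vars (Id_Lit x y) = {x, y}"

definition literals :: "('x, 'l) graph_pattern \<Rightarrow> ('x, 'a, 'c) literal set" where
  "literals Q = {p. literal_vars p \<subseteq> pvars Q}"

fun sat_literal ::
    "('v, 'l, 'a, 'c, 'i) property_graph \<Rightarrow> ('x \<Rightarrow> 'v) \<Rightarrow> ('x, 'a, 'c) literal \<Rightarrow> bool" where
  "sat_literal G h (Const_Lit x A c) \<longleftrightarrow> attr_val G (h x) A = Some c"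
| "sat_literal G h (Var_Lit x A y A') \<longleftrightarrow>
     (\<exists>c. attr_val G (h x) A = Some c \<and> attr_val G (h y) A' = Some c)"
| "sat_literal G h (Id_Lit x y) \<longleftrightarrow> node_id G (h x) = node_id G (h y)"

(* An item-name is an attribute of a pattern variable (or such a pair, for variable items):
   the name of an item encoding x.A = c is "A of x", so that items for the same attribute of
   two different variables have different names. *)
datatype ('x, 'a) item_name =
    Attr_Of 'x 'a
  | Attr_Pair 'x 'a 'x 'a
  | Id_Pair 'x 'x

(* (\<alpha>, u, c) stands for \<alpha>[u;c]; the placeholder "_" is None. *)
type_synonym ('x, 'a, 'c) item = "('x, 'a) item_name \<times> 'x set \<times> 'c option"

definition name_of :: "('x, 'a, 'c) item \<Rightarrow> ('x, 'a) item_name" where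
  "name_of b = fst b"

fun encode :: "('x, 'a, 'c) literal \<Rightarrow> ('x, 'a, 'c) item" where
  "encode (Const_Lit x A c) = (Attr_Of x A, {x}, Some c)"
| "encode (Var_Lit x A y A') = (Attr_Pair x A y A', {x, y}, None)"
| "encode (Id_Lit x y) = (Id_Pair x y, {x, y}, None)"

lemma encode_inject: "encode p = encode q \<longleftrightarrow> p = q"
  by (cases p; cases q) auto

(* Variable items relate pattern variables of the same kind, i.e. with the same label in Q. *)
definition items :: "('x, 'l) graph_pattern \<Rightarrow> ('x, 'a, 'c) item set" where
  "items Q = encode `
     {p \<in> literals Q. \<forall>x \<in> literal_vars p. \<forall>y \<in> literal_vars p. plabel Q x = plabel Q y}"

(* By encode_inject the encoded literal p is unique. *)
definition sat_item ::
    "('v, 'l, 'a, 'c, 'i) property_graph \<Rightarrow> ('x \<Rightarrow> 'v) \<Rightarrow> ('x, 'a, 'c) item \<Rightarrow> bool" where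
  "sat_item G h b \<longleftrightarrow> (\<exists>p. encode p = b \<and> sat_literal G h p)"

definition itemset :: "('x, 'a, 'c) item set \<Rightarrow> bool" where
  "itemset X \<longleftrightarrow> inj_on name_of X"

definition sat_items ::
    "('v, 'l, 'a, 'c, 'i) property_graph \<Rightarrow> ('x \<Rightarrow> 'v) \<Rightarrow> ('x, 'a, 'c) item set \<Rightarrow> bool" where
  "sat_items G h X \<longleftrightarrow> (\<forall>b \<in> X. sat_item G h b)"

definition dependency_holds ::
    "('v, 'l, 'a, 'c, 'i) property_graph \<Rightarrow> ('x \<Rightarrow> 'v) set \<Rightarrow>
     ('x, 'a, 'c) item set \<Rightarrow> ('x, 'a, 'c) item \<Rightarrow> bool" where
  "dependency_holds G H X b \<longleftrightarrow> (\<forall>h \<in> H. sat_items G h X \<longrightarrow> sat_item G h b)"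

definition disagree ::
    "('v, 'l, 'a, 'c, 'i) property_graph \<Rightarrow> ('x, 'l) graph_pattern \<Rightarrow> ('x \<Rightarrow> 'v) \<Rightarrow>
     ('x, 'a, 'c) item set" where
  "disagree G Q h = {b \<in> items Q. \<not> sat_item G h b}"

definition nec ::
    "('v, 'l, 'a, 'c, 'i) property_graph \<Rightarrow> ('x, 'l) graph_pattern \<Rightarrow>
     ('x, 'a, 'c) item \<Rightarrow> ('x, 'a, 'c) item set set" where
  "nec G Q b = {disagree G Q h - {b} | h. h \<in> matches G Q \<and> b \<in> disagree G Q h}"

definition covers :: "'b set \<Rightarrow> 'b set set \<Rightarrow> bool" where
  "covers M F \<longleftrightarrow> (\<forall>Y \<in> F. Y \<inter> M \<noteq> {})"

end

(* Contrapositively, a match violating X \<rightarrow> b is a match h with b in D(h) and X disjoint from D(h);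
   since b is not in X, the latter says that D(h) - {b}, a member of nec(b), misses X. *)
theory Submission
  imports Defs
begin

theorem mainTheorem1:
  fixes G :: "('v, 'l :: {countable, infinite}, 'a :: {countable, infinite},
               'c :: {countable, infinite}, 'i) property_graph"
    and Q :: "('x, 'l) graph_pattern"
    and X :: "('x, 'a, 'c) item set"
    and b :: "('x, 'a, 'c) item"
  assumes "property_graph G"
    and "graph_pattern Q"
    and "X \<subseteq> items Q" and "itemset X"
    and "b \<in> items Q" and "b \<notin> X"
  shows "dependency_holds G (matches G Q) X b \<longleftrightarrow> covers X (nec G Q b)"
proof -
  let ?D = "disagree G Q :: ('x \<Rightarrow> 'v) \<Rightarrow> ('x, 'a, 'c) item set"
  have D_b: "b \<in> ?D h \<longleftrightarrow> \<not> sat_item G h b" for h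
    using assms(5) by (simp add: disagree_def)
  \<comment> \<open>\<open>X \<subseteq> items Q\<close> ensures that every violated member of
    \<open>X\<close> occurs in \<open>?D h\<close>; \<open>b \<notin> X\<close> ensures that
    removing \<open>b\<close> loses none of them.\<close>
  have D_X: "(?D h - {b}) \<inter> X = {} \<longleftrightarrow> sat_items G h X" for h
    using assms(3,6) by (auto simp: disagree_def sat_items_def)
  \<comment> \<open>The family \<open>nec G Q b\<close> is indexed by the matches that violate
    \<open>b\<close>, so \<open>Y\<close> can be traded for \<open>h\<close>.\<close>
  have "covers X (nec G Q b) \<longleftrightarrow>
      (\<forall>h \<in> matches G Q. b \<in> ?D h \<longrightarrow> (?D h - {b}) \<inter> X \<noteq> {})"
    unfolding covers_def nec_def by blast
  \<comment> \<open>For each \<open>h\<close> the two implications are now contrapositives.\<close>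
  also have "\<dots> \<longleftrightarrow> dependency_holds G (matches G Q) X b"
    unfolding D_b D_X dependency_holds_def by blast
  finally show ?thesis
    by (rule sym)
qed

end
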